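(* Let $X$ be a Banach space over $\mathbb{K}\in\{\mathbb{R},\mathbb{C}\}$, let $\Lambda$ be a nonempty set, and let $X_\lambda$, $\lambda\in\Lambda$, be closed linear subspaces of $X$. Then the family $(X_\lambda)_{\lambda\in\Lambda}$ is an absolutely representing family of subspaces (ARFS) in $X$ if and only if there exists $\varepsilon>0$ such that $$\sup_{\lambda\in\Lambda}\rho_0(X_\lambda,Y)\geqslant\varepsilon$$ for every closed linear subspace $Y\subset X$ with $Y\neq X$.
   Context: The family $(X_\lambda)_{\lambda\in\Lambda}$ of closed linear subspaces of $X$ is called an absolutely representing family of subspaces (ARFS) in $X$ if for every $x\in X$ there exist $x_\lambda\in X_\lambda$, $\lambda\in\Lambda$, such that $\sum_{\lambda\in\Lambda}\|x_\lambda\|<\infty$ and $x=\sum_{\lambda\in\Lambda}x_\lambda$. For closed linear subspaces $Y,Z\subset X$, $\rho_0(Y,Z)=\sup\{d(y,Z)\mid y\in Y,\ \|y\|=1\}$, where $d(y,Z)=\inf_{z\in Z}\|y-z\|$; if $Y=\{0\}$, then $\rho_0(Y,Z)=0$. *)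

theory Defs
  imports "HOL-Analysis.Analysis"
begin

text \<open>
  The scalar fields: up to isometric isomorphism of fields, exactly the reals and the
  complex numbers.
\<close>

class real_or_complex = real_normed_field +
  assumes real_or_complex:
    "\<exists>h :: 'a \<Rightarrow> complex.
       (\<forall>x y. h (x + y) = h x + h y) \<and> (\<forall>x y. h (x * y) = h x * h y) \<and> h 1 = 1 \<and>
       (\<forall>x. norm (h x) = norm x) \<and> (range h = \<real> \<or> range h = UNIV)"

instance real :: real_or_complex
proof
  show "\<exists>h :: real \<Rightarrow> complex.
       (\<forall>x y. h (x + y) = h x + h y) \<and> (\<forall>x y. h (x * y) = h x * h y) \<and> h 1 = 1 \<and>
       (\<forall>x. norm (h x) = norm x) \<and> (range h = \<real> \<or> range h = UNIV)"
    by (rule exI[of _ of_real]) (auto simp: Reals_def)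
qed

instance complex :: real_or_complex
proof
  show "\<exists>h :: complex \<Rightarrow> complex.
       (\<forall>x y. h (x + y) = h x + h y) \<and> (\<forall>x y. h (x * y) = h x * h y) \<and> h 1 = 1 \<and>
       (\<forall>x. norm (h x) = norm x) \<and> (range h = \<real> \<or> range h = UNIV)"
    by (rule exI[of _ id]) auto
qed

text \<open>
  The library has a type class for real normed spaces only, so the scalar multiplication is
  a parameter. The real vector space structure that the type class provides has to be the one
  obtained by restricting the scalars; for \<^typ>\<open>real\<close> this forces \<open>smul = scaleR\<close>. Completeness
  does not depend on the scalars: a Banach space is the case where \<open>'a\<close> has class \<^class>\<open>banach\<close>.
\<close>

locale normed_space_over = vector_space smul
  for smul :: "'k::real_or_complex \<Rightarrow> 'a::real_normed_vector \<Rightarrow> 'a" +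
  assumes norm_scale: "norm (smul c x) = norm c * norm x"
    and scale_of_real: "smul (of_real r) x = r *\<^sub>R x"

lemma normed_space_over_scaleR:
  "normed_space_over (scaleR :: real \<Rightarrow> 'a::real_normed_vector \<Rightarrow> 'a)"
  by unfold_locales (auto simp: scaleR_add_right scaleR_add_left)

lemma normed_space_over_mult: "normed_space_over ((*) :: 'k::real_or_complex \<Rightarrow> 'k \<Rightarrow> 'k)"
  by unfold_locales (auto simp: distrib_left distrib_right norm_mult scaleR_conv_of_real mult.assoc)

definition closed_subspace ::
    "('k::real_or_complex \<Rightarrow> 'a::real_normed_vector \<Rightarrow> 'a) \<Rightarrow> 'a set \<Rightarrow> bool" where
  "closed_subspace smul Y \<longleftrightarrow> module.subspace smul Y \<and> closed Y"

definition ARFS :: "'i set \<Rightarrow> ('i \<Rightarrow> 'a::real_normed_vector set) \<Rightarrow> bool" where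
  "ARFS \<Lambda> X \<longleftrightarrow>
     (\<forall>x. \<exists>u. (\<forall>l\<in>\<Lambda>. u l \<in> X l) \<and> u abs_summable_on \<Lambda> \<and> (u has_sum x) \<Lambda>)"

definition rho0 :: "'a::real_normed_vector set \<Rightarrow> 'a set \<Rightarrow> real" where
  "rho0 Y Z = (if Y = {0} then 0 else SUP y\<in>{y\<in>Y. norm y = 1}. infdist y Z)"

text \<open>
  For subspaces, the suprema of reals in \<^const>\<open>rho0\<close>, and over a nonempty family of values of
  \<^const>\<open>rho0\<close>, are taken over nonempty sets bounded by 1, hence are genuine least upper bounds.
\<close>

lemma (in normed_space_over) unit_sphere_nonempty:
  assumes "subspace Y" "Y \<noteq> {0}"
  shows "{y\<in>Y. norm y = 1} \<noteq> {}"
proof -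
  obtain y where y: "y \<in> Y" "y \<noteq> 0"
    using assms subspace_0 by blast
  have "smul (of_real (inverse (norm y))) y \<in> Y"
    using assms(1) y(1) by (rule subspace_scale)
  moreover have "norm (smul (of_real (inverse (norm y))) y) = 1"
    using y(2) by (simp add: norm_scale norm_inverse)
  ultimately show ?thesis by blast
qed

lemma (in normed_space_over) infdist_le_norm:
  assumes "subspace Z"
  shows "infdist y Z \<le> norm y"
  using infdist_le[OF subspace_0[OF assms], of y] by simp

lemma (in normed_space_over) rho0_le_1:
  assumes "subspace Y" "subspace Z"
  shows "rho0 Y Z \<le> 1"
proof (cases "Y = {0}")
  case False
  have "(SUP y\<in>{y\<in>Y. norm y = 1}. infdist y Z) \<le> 1"
  proof (rule cSUP_least)
    show "{y\<in>Y. norm y = 1} \<noteq> {}"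
      by (rule unit_sphere_nonempty[OF assms(1) False])
    show "infdist y Z \<le> 1" if "y \<in> {y\<in>Y. norm y = 1}" for y
      using infdist_le_norm[OF assms(2), of y] that by simp
  qed
  then show ?thesis using False by (simp add: rho0_def)
qed (simp add: rho0_def)

end

theory Submission
  imports Defs
begin

text \<open>
  Necessity: if every vector has an absolutely convergent decomposition, then by Baire's theorem
  the sums of the decompositions of cost \<open>\<Sum>\<parallel>x\<^sub>\<lambda>\<parallel> \<le> n\<close> are dense in some ball. Since
  \<open>d(\<Sum>x\<^sub>\<lambda>, Y) \<le> sup \<rho>\<^sub>0(X\<^sub>\<lambda>, Y) \<cdot> \<Sum>\<parallel>x\<^sub>\<lambda>\<parallel>\<close>, a too small supremum would give
  \<open>d(x, Y) \<le> \<parallel>x\<parallel> / 2\<close> for all \<open>x\<close>, which forces \<open>Y = X\<close>.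

  Sufficiency: put \<open>M = 4 / \<epsilon>\<close> and consider the seminorm
  \<open>q(x) = inf (\<Sum>\<parallel>x\<^sub>\<lambda>\<parallel> + M \<parallel>x - \<Sum>x\<^sub>\<lambda>\<parallel>)\<close>. If \<open>q(a) > M \<parallel>a\<parallel> / 2\<close> for some \<open>a\<close>, then a
  Hahn-Banach functional \<open>F\<close> with \<open>|F| \<le> q\<close> and \<open>|F(a)| = q(a)\<close> has a kernel \<open>Y\<close> with
  \<open>\<rho>\<^sub>0(X\<^sub>\<lambda>, Y) \<le> 2 / M < \<epsilon>\<close> for all \<open>\<lambda>\<close>. Hence \<open>q(x) \<le> M \<parallel>x\<parallel> / 2\<close> for all \<open>x\<close>, so every \<open>x\<close> is
  approximated up to \<open>3/4 \<parallel>x\<parallel>\<close> at cost \<open>\<le> M \<parallel>x\<parallel>\<close>, and iterating gives a decomposition of \<open>x\<close>.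
\<close>

no_notation Infinite_Set_Sum.abs_summable_on (infix \<open>abs'_summable'_on\<close> 50)

text \<open>Proves subadditivity of functions defined as infima without choosing near-minimisers: it
  suffices to compare with arbitrary competitors. It serves the sublinear functionals,
  \<open>infdist\<close> and the seminorm \<open>q\<close> alike.\<close>

lemma le_cINF_add:
  fixes f :: "'b \<Rightarrow> real" and g :: "'c \<Rightarrow> real"
  assumes "I \<noteq> {}" "J \<noteq> {}" "\<And>i j. i \<in> I \<Longrightarrow> j \<in> J \<Longrightarrow> a \<le> f i + g j"
  shows "a \<le> (INF i\<in>I. f i) + (INF j\<in>J. g j)"
proof -
  have "a - (INF j\<in>J. g j) \<le> f i" if "i \<in> I" for i
  proof -
    have "a - f i \<le> (INF j\<in>J. g j)"
      using assms(2) by (rule cINF_greatest) (use assms(3) that in force)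
    then show ?thesis by simp
  qed
  then have "a - (INF j\<in>J. g j) \<le> (INF i\<in>I. f i)"
    using assms(1) by (intro cINF_greatest)
  then show ?thesis by simp
qed

lemma le_mult_cINF:
  fixes f :: "'b \<Rightarrow> real"
  assumes "I \<noteq> {}" "r > 0" "\<And>i. i \<in> I \<Longrightarrow> a \<le> r * f i"
  shows "a \<le> r * (INF i\<in>I. f i)"
proof -
  have "a / r \<le> (INF i\<in>I. f i)"
    using assms(1) by (rule cINF_greatest) (use assms in \<open>simp add: field_simps\<close>)
  then show ?thesis
    using assms(2) by (simp add: field_simps)
qed

subsection \<open>The Hahn-Banach theorem over the real or complex numbers\<close>

text \<open>Only an inequality for positive factors is demanded, because that is what passes
  directly to infima; \<open>sublinear_scale\<close> recovers equality and the value 0 at the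
  origin.\<close>

definition sublinear :: "('a::real_vector \<Rightarrow> real) \<Rightarrow> bool" where
  "sublinear p \<longleftrightarrow> (\<forall>x y. p (x + y) \<le> p x + p y) \<and> (\<forall>r>0. \<forall>x. p (r *\<^sub>R x) \<le> r * p x)"

lemma sublinear_add: "sublinear p \<Longrightarrow> p (x + y) \<le> p x + p y"
  by (simp add: sublinear_def)

lemma sublinear_scale_le: "sublinear p \<Longrightarrow> r > 0 \<Longrightarrow> p (r *\<^sub>R x) \<le> r * p x"
  by (simp add: sublinear_def)

lemma sublinear_scale:
  assumes "sublinear p" "r \<ge> 0"
  shows "p (r *\<^sub>R x) = r * p x"
proof (cases "r = 0")
  case True
  \<comment> \<open>The first inequality gives \<open>p 0 \<ge> 0\<close>, the second
    \<open>p 0 \<le> 0\<close>.\<close>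
  have "p 0 \<le> p 0 + p 0" "p 0 \<le> (1/2) * p 0"
    using sublinear_add[OF assms(1), of 0 0] sublinear_scale_le[OF assms(1), of "1/2" 0] by auto
  then show ?thesis using True by simp
next
  case False
  then have "r > 0" using assms(2) by simp
  moreover have "p x \<le> inverse r * p (r *\<^sub>R x)"
    using sublinear_scale_le[OF assms(1), of "inverse r" "r *\<^sub>R x"] \<open>r > 0\<close> by simp
  ultimately show ?thesis
    using sublinear_scale_le[OF assms(1) \<open>r > 0\<close>, of x] by (simp add: field_simps)
qed

lemma sublinear_ge_uminus:
  assumes "sublinear p"
  shows "- p (- x) \<le> p x"
  using sublinear_add[OF assms, of x "- x"] sublinear_scale[OF assms, of 0 0] by simp

text \<open>
  Applied to a minimal sublinear functional this gives \<open>p (- a) = - p a\<close>, i.e. linearity; applied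
  to the given one, it makes every linear functional below \<open>q\<close> attain \<open>p\<close> at \<open>a\<close>.
\<close>

lemma sublinear_improve:
  fixes p :: "'a::real_vector \<Rightarrow> real"
  assumes p: "sublinear p"
  obtains q where "sublinear q" "q \<le> p" "q (- a) \<le> - p a"
proof
  \<comment> \<open>Competitors move \<open>x\<close> along the ray in direction \<open>a\<close>.
    Taking \<open>t = 0\<close> yields \<open>q \<le> p\<close>; taking \<open>t = 1\<close> at the
    point \<open>- a\<close> yields \<open>p 0 - p a = - p a\<close>.\<close>
  define q where "q x = (INF t\<in>{0..}. p (x + t *\<^sub>R a) - t * p a)" for x
  have lb: "- p (- x) \<le> p (x + t *\<^sub>R a) - t * p a" if "t \<ge> 0" for x t
    using sublinear_add[OF p, of "x + t *\<^sub>R a" "- x"] sublinear_scale[OF p that, of a] by simp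
  then have bdd: "bdd_below ((\<lambda>t. p (x + t *\<^sub>R a) - t * p a) ` {0..})" for x
    by (intro bdd_belowI2[where m = "- p (- x)"]) auto
  have q_le: "q x \<le> p (x + t *\<^sub>R a) - t * p a" if "t \<ge> 0" for x t
    unfolding q_def using bdd that by (intro cINF_lower) auto
  show "sublinear q"
    unfolding sublinear_def
  proof (intro conjI allI impI)
    fix x y
    show "q (x + y) \<le> q x + q y"
      unfolding q_def[of x] q_def[of y]
    proof (rule le_cINF_add)
      fix s t :: real
      assume st: "s \<in> {0..}" "t \<in> {0..}"
      have "q (x + y) \<le> p (x + y + (s + t) *\<^sub>R a) - (s + t) * p a"
        using st by (intro q_le) auto
      also have "p (x + y + (s + t) *\<^sub>R a) \<le> p (x + s *\<^sub>R a) + p (y + t *\<^sub>R a)"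
        using sublinear_add[OF p, of "x + s *\<^sub>R a" "y + t *\<^sub>R a"] by (simp add: algebra_simps)
      finally show "q (x + y) \<le> (p (x + s *\<^sub>R a) - s * p a) + (p (y + t *\<^sub>R a) - t * p a)"
        by (simp add: algebra_simps)
    qed auto
  next
    fix r :: real and x
    assume r: "r > 0"
    show "q (r *\<^sub>R x) \<le> r * q x"
      unfolding q_def[of x]
    proof (rule le_mult_cINF)
      fix t :: real
      assume "t \<in> {0..}"
      then have "q (r *\<^sub>R x) \<le> p (r *\<^sub>R x + (r * t) *\<^sub>R a) - r * t * p a"
        using r by (intro q_le) auto
      also have "p (r *\<^sub>R x + (r * t) *\<^sub>R a) = r * p (x + t *\<^sub>R a)"
        using sublinear_scale[OF p, of r "x + t *\<^sub>R a"] r by (simp add: algebra_simps)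
      finally show "q (r *\<^sub>R x) \<le> r * (p (x + t *\<^sub>R a) - t * p a)"
        by (simp add: algebra_simps)
    qed (use r in auto)
  qed
  show "q \<le> p"
    using q_le[of 0] by (auto simp: le_fun_def)
  show "q (- a) \<le> - p a"
    using q_le[of 1 "- a"] sublinear_scale[OF p, of 0 0] by simp
qed

text \<open>Zorn's lemma for the reversed pointwise order. A nonempty chain is bounded by its
  pointwise infimum, which is finite because each member is at least \<open>- p (- x)\<close> at
  \<open>x\<close>.\<close>

lemma sublinear_minimal_exists:
  fixes p :: "'a::real_vector \<Rightarrow> real"
  assumes p: "sublinear p"
  obtains m where "sublinear m" "m \<le> p" "\<And>q. sublinear q \<Longrightarrow> q \<le> m \<Longrightarrow> q = m"
proof -
  define A where "A = {q. sublinear q \<and> q \<le> p}"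
  have "\<exists>m\<in>A. \<forall>q\<in>A. q \<le> m \<longrightarrow> q = m"
  proof (rule predicate_Zorn)
    show "partial_order_on A (relation_of (\<lambda>q m. m \<le> q) A)"
      by (auto simp: partial_order_on_def preorder_on_def refl_on_def relation_of_def
          intro!: transI antisymI)
  next
    fix C
    assume "C \<in> Chains (relation_of (\<lambda>q m. m \<le> q) A)"
    then have CA: "C \<subseteq> A" and chain: "\<And>c d. c \<in> C \<Longrightarrow> d \<in> C \<Longrightarrow> c \<le> d \<or> d \<le> c"
      by (auto simp: Chains_def relation_of_def)
    show "\<exists>u\<in>A. \<forall>a\<in>C. u \<le> a"
    proof (cases "C = {}")
      case True
      then show ?thesis using p by (auto simp: A_def)
    next
      case False
      define u where "u x = (INF c\<in>C. c x)" for x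
      have sub: "sublinear c" and le_p: "c \<le> p" if "c \<in> C" for c
        using that CA by (auto simp: A_def)
      have "- p (- x) \<le> c x" if "c \<in> C" for c x
        using sublinear_ge_uminus[OF sub[OF that], of x] le_funD[OF le_p[OF that], of "- x"] by simp
      then have bdd: "bdd_below ((\<lambda>c. c x) ` C)" for x
        by (intro bdd_belowI2[where m = "- p (- x)"]) auto
      have u_le: "u x \<le> c x" if "c \<in> C" for c x
        unfolding u_def using bdd that by (intro cINF_lower) auto
      have "sublinear u"
        unfolding sublinear_def
      proof (intro conjI allI impI)
        fix x y
        show "u (x + y) \<le> u x + u y"
          unfolding u_def[of x] u_def[of y]
        proof (rule le_cINF_add)
          fix c d
          assume cd: "c \<in> C" "d \<in> C"
          \<comment> \<open>Here the chain property enters: one member lies below both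
            \<open>c\<close> and \<open>d\<close>, and its subadditivity bounds the mixed
            sum.\<close>
          obtain e where e: "e \<in> C" "e \<le> c" "e \<le> d"
            using chain[OF cd] cd by blast
          have "u (x + y) \<le> e x + e y"
            using u_le[OF e(1), of "x + y"] sublinear_add[of e x y] sub[OF e(1)] by simp
          also have "\<dots> \<le> c x + d y"
            using e by (intro add_mono) (auto simp: le_fun_def)
          finally show "u (x + y) \<le> c x + d y" .
        qed (use False in auto)
      next
        fix r :: real and x
        assume r: "r > 0"
        show "u (r *\<^sub>R x) \<le> r * u x"
          unfolding u_def[of x]
        proof (rule le_mult_cINF)
          fix c
          assume "c \<in> C"
          then show "u (r *\<^sub>R x) \<le> r * c x"
            using u_le[of c "r *\<^sub>R x"] sublinear_scale_le[of c r x] sub[of c] r by simp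
        qed (use False r in auto)
      qed
      moreover have "u \<le> p"
      proof -
        obtain c where "c \<in> C" using False by blast
        then show ?thesis using u_le le_p by (meson le_funI order_trans le_funD)
      qed
      ultimately show ?thesis
        using u_le by (auto simp: A_def le_fun_def)
    qed
  qed
  then obtain m where m: "m \<in> A" "\<And>q. q \<in> A \<Longrightarrow> q \<le> m \<Longrightarrow> q = m"
    by blast
  show thesis
  proof (rule that)
    show "q = m" if "sublinear q" "q \<le> m" for q
    proof (rule m(2))
      have "m \<le> p" using m(1) by (simp add: A_def)
      with that show "q \<in> A" unfolding A_def by (blast intro: order_trans)
    qed (rule that(2))
    show "sublinear m" "m \<le> p"
      using m(1) by (simp_all add: A_def)
  qed
qed

text \<open>Minimality makes \<open>m\<close> odd, since improving it in any direction changes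
  nothing. Subadditivity at \<open>x\<close>, \<open>y\<close> and at \<open>- x\<close>,
  \<open>- y\<close> then gives both inequalities of additivity.\<close>

lemma sublinear_minimal_imp_linear:
  assumes m: "sublinear m" and min: "\<And>q. sublinear q \<Longrightarrow> q \<le> m \<Longrightarrow> q = m"
  shows "linear m"
proof -
  have neg: "m (- x) = - m x" for x
  proof -
    obtain q where "sublinear q" "q \<le> m" "q (- x) \<le> - m x"
      using sublinear_improve[OF m] by blast
    then have "m (- x) \<le> - m x" using min by blast
    then show ?thesis using sublinear_ge_uminus[OF m, of "- x"] by simp
  qed
  show ?thesis
  proof (rule linearI)
    show "m (x + y) = m x + m y" for x y
      using sublinear_add[OF m, of x y] sublinear_add[OF m, of "- x" "- y"] neg[of "x + y"]
      by (simp add: neg)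
    show "m (r *\<^sub>R x) = r *\<^sub>R m x" for r x
    proof (cases "r \<ge> 0")
      case False
      then show ?thesis
        using sublinear_scale[OF m, of "- r" x] neg[of "r *\<^sub>R x"] by simp
    qed (use sublinear_scale[OF m] in simp)
  qed
qed

text \<open>Instead of extending from a subspace, \<open>p\<close> is lowered at \<open>- a\<close>
  and a minimal sublinear functional is taken below the result; its linearity turns the bound at
  \<open>- a\<close> into \<open>f a \<ge> p a\<close>.\<close>

theorem real_Hahn_Banach:
  fixes p :: "'a::real_vector \<Rightarrow> real"
  assumes p: "sublinear p"
  obtains f where "linear f" "\<And>x. f x \<le> p x" "f a = p a"
proof -
  obtain q where q: "sublinear q" "q \<le> p" "q (- a) \<le> - p a"
    using sublinear_improve[OF p] by blast
  obtain f where f: "sublinear f" "f \<le> q" "\<And>g. sublinear g \<Longrightarrow> g \<le> f \<Longrightarrow> g = f"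
    using sublinear_minimal_exists[OF q(1)] by blast
  have lin: "linear f"
    using f(1,3) by (rule sublinear_minimal_imp_linear)
  have le: "f x \<le> p x" for x
    using le_funD[OF f(2), of x] le_funD[OF q(2), of x] by simp
  have "- f a \<le> - p a"
    using le_funD[OF f(2), of "- a"] q(3) linear_neg[OF lin, of a] by simp
  with le[of a] have "f a = p a" by simp
  with lin le show thesis using that by blast
qed

text \<open>Replaces the embedding \<open>h\<close> by what Hahn-Banach uses: either all scalars are
  real, or there is an imaginary unit \<open>j\<close> with real coordinates and the usual
  modulus.\<close>

lemma of_real_or_complex_cases:
  obtains (real) "\<And>c::'k::real_or_complex. c \<in> \<real>"
  | (complex) j :: "'k::real_or_complex" where "j * j = -1"
      "\<And>c. \<exists>a b. c = of_real a + of_real b * j"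
      "\<And>a b. norm (of_real a + of_real b * j) = cmod (Complex a b)"
proof -
  obtain h :: "'k \<Rightarrow> complex" where
    add: "\<And>x y. h (x + y) = h x + h y" and mult: "\<And>x y. h (x * y) = h x * h y"
    and one: "h 1 = 1" and nrm: "\<And>x. norm (h x) = norm x"
    and rng: "range h = \<real> \<or> range h = UNIV"
    using real_or_complex by blast
  have zero: "h 0 = 0" using nrm[of 0] by simp
  have neg: "h (- x) = - h x" for x
    using add[of x "- x"] zero by (simp add: eq_neg_iff_add_eq_0 add.commute)
  have diff: "h (x - y) = h x - h y" for x y
    using add[of x "- y"] neg by simp
  have inj: "x = y" if "h x = h y" for x y
    using nrm[of "x - y"] that by (simp add: diff)
  \<comment> \<open>That \<open>h\<close> fixes the reals follows from isometry: the image has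
    modulus \<open>\<bar>r\<bar>\<close> and distance \<open>\<bar>r - 1\<bar>\<close> from 1.
    Subtracting the squared equations determines the real part, and then the imaginary part
    vanishes.\<close>
  have of_real: "h (of_real r) = of_real r" for r
  proof -
    have "cmod (h (of_real r)) = \<bar>r\<bar>" "cmod (h (of_real r) - 1) = \<bar>r - 1\<bar>"
      using nrm[of "of_real r"] nrm[of "of_real r - 1"] norm_of_real[of "r - 1", where 'a = 'k]
      by (simp_all add: diff one)
    then have "(Re (h (of_real r)))\<^sup>2 + (Im (h (of_real r)))\<^sup>2 = r\<^sup>2"
      "(Re (h (of_real r)) - 1)\<^sup>2 + (Im (h (of_real r)))\<^sup>2 = (r - 1)\<^sup>2"
      by (metis cmod_power2 power2_abs, metis cmod_power2 power2_abs minus_complex.sel one_complex.sel diff_zero)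
    then have "Re (h (of_real r)) = r" "Im (h (of_real r)) = 0"
      by (auto simp: power2_eq_square algebra_simps)
    then show ?thesis by (simp add: complex_eq_iff)
  qed
  show thesis
    using rng
  proof
    assume R: "range h = \<real>"
    have "c \<in> \<real>" for c :: 'k
    proof -
      obtain r where "h c = of_real r" using R by (metis Reals_cases rangeI)
      then have "c = of_real r" using of_real inj by metis
      then show ?thesis by simp
    qed
    then show thesis by (rule real)
  next
    assume U: "range h = UNIV"
    then obtain j where j: "h j = \<i>" by (metis UNIV_I imageE)
    have hab: "h (of_real a + of_real b * j) = Complex a b" for a b
      by (simp add: add mult of_real j complex_eq_iff)
    show thesis
    proof (rule complex)
      show "j * j = -1" by (rule inj) (simp add: mult j neg one)
      show "\<exists>a b. c = of_real a + of_real b * j" for c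
        using hab inj by (metis complex.collapse)
      show "norm (of_real a + of_real b * j) = cmod (Complex a b)" for a b
        using hab nrm by metis
    qed
  qed
qed

context normed_space_over
begin

lemma Hahn_Banach:
  fixes q :: "'a \<Rightarrow> real"
  assumes q_add: "\<And>x y. q (x + y) \<le> q x + q y" and q_scale: "\<And>c x. q (smul c x) = norm c * q x"
  obtains F :: "'a \<Rightarrow> 'k" where "\<And>x y. F (x + y) = F x + F y" "\<And>c x. F (smul c x) = c * F x"
    "\<And>x. norm (F x) \<le> q x" "q a \<le> norm (F a)"
proof -
  have "sublinear q"
    unfolding sublinear_def using q_add q_scale[of "of_real _"] by (auto simp: scale_of_real)
  then obtain f where f: "linear f" "\<And>x. f x \<le> q x" "f a = q a"
    using real_Hahn_Banach by blast
  note f_add = linear_add[OF f(1)] and f_scale = linear_scale[OF f(1)]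
  have f_real: "f (smul (of_real r) x) = r * f x" for r x
    by (simp add: scale_of_real f_scale)
  note result = that
  \<comment> \<open>Common to both scalar fields: a linear \<open>F\<close> that agrees with
    \<open>f\<close> wherever \<open>F\<close> takes real values inherits the bound
    \<open>q\<close>.\<close>
  have main: thesis
    if F: "\<And>x y. F (x + y) = F x + F y" "\<And>c x. F (smul c x) = c * F x"
      and F_real: "\<And>x r. F x = of_real r \<Longrightarrow> f x = r"
      and F_ge: "\<And>x. f x \<le> norm (F x)"
    for F :: "'a \<Rightarrow> 'k"
  proof (rule result)
    show "norm (F x) \<le> q x" for x
    proof (cases "F x = 0")
      case True
      then show ?thesis using F_real[of x 0] f(2)[of x] by simp
    next
      case False
      \<comment> \<open>A unimodular factor rotating \<open>F x\<close> to its norm. At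
        \<open>smul c x\<close> the real functional \<open>f\<close> takes that norm as its value,
        while \<open>q\<close> is unchanged.\<close>
      define c where "c = of_real (norm (F x)) / F x"
      have "norm c = 1" using False by (simp add: c_def norm_divide)
      have "F (smul c x) = of_real (norm (F x))"
        using False by (simp add: F(2) c_def)
      then show ?thesis
        using F_real f(2)[of "smul c x"] q_scale[of c x] \<open>norm c = 1\<close> by simp
    qed
    show "q a \<le> norm (F a)" using F_ge[of a] f(3) by simp
  qed (use F in auto)
  show thesis
  proof (cases rule: of_real_or_complex_cases[where 'k = 'k])
    case real
    show thesis
    proof (rule main[of "\<lambda>x. of_real (f x)"])
      fix c :: 'k and x :: 'a
      obtain r where "c = of_real r" using real[of c] by (elim Reals_cases)
      then show "of_real (f (smul c x)) = c * of_real (f x)" by (simp add: f_real)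
    qed (auto simp: f_add)
  next
    case (complex j)
    \<comment> \<open>The standard complexification: the complex-linear functional with real part
      \<open>f\<close>.\<close>
    define F where "F x = of_real (f x) - of_real (f (smul j x)) * j" for x
    have F_alt: "F x = of_real (f x) + of_real (- f (smul j x)) * j" for x
      by (simp add: F_def)
    have F_add: "F (x + y) = F x + F y" for x y
      by (simp add: F_def f_add scale_right_distrib algebra_simps)
    have F_real: "F (smul (of_real r) x) = of_real r * F x" for r x
      using f_real[of r "smul j x"]
      by (simp add: F_def f_real scale_left_commute algebra_simps del: scale_scale)
    have F_j: "F (smul j x) = j * F x" for x
    proof -
      have "f (smul (j * j) x) = - f x"
        using f_real[of "-1" x] complex(1) by simp
      then show ?thesis
        using complex(1) by (simp add: F_def algebra_simps mult.assoc[symmetric])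
    qed
    show thesis
    proof (rule main[of F])
      fix c :: 'k and x :: 'a
      obtain a b where c: "c = of_real a + of_real b * j" using complex(2) by blast
      have "F (smul c x) = F (smul (of_real a) x) + F (smul (of_real b) (smul j x))"
        by (simp add: c scale_left_distrib F_add)
      then show "F (smul c x) = c * F x"
        by (simp add: F_real F_j c algebra_simps del: scale_scale)
    next
      fix x r
      assume "F x = of_real r"
      then have "of_real (f x - r) + of_real (- f (smul j x)) * j = 0"
        by (simp add: F_alt algebra_simps)
      then have "Complex (f x - r) (- f (smul j x)) = 0"
        using complex(3)[of "f x - r" "- f (smul j x)"] by simp
      then show "f x = r" by (simp add: complex_eq_iff)
    next
      show "f x \<le> norm (F x)" for x
        using complex(3)[of "f x" "- f (smul j x)"] complex_Re_le_cmod[of "Complex (f x) (- f (smul j x))"]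
        by (simp add: F_alt)
    qed (rule F_add)
  qed
qed

end

section \<open>Infinite sums in closed sets, and Baire's theorem\<close>

lemma closed_infsum_mem:
  fixes f :: "'b \<Rightarrow> 'a::{comm_monoid_add,t2_space}"
  assumes "closed S" "f summable_on A" "\<And>F. finite F \<Longrightarrow> F \<subseteq> A \<Longrightarrow> sum f F \<in> S"
  shows "infsum f A \<in> S"
  by (rule Lim_in_closed_set[OF assms(1) _ _ infsum_tendsto[OF assms(2)]])
     (use assms(3) in \<open>auto simp: eventually_finite_subsets_at_top_weakI\<close>)

lemma Baire_interior_nonempty:
  fixes A :: "nat \<Rightarrow> 'a::banach set"
  assumes "\<And>n. closed (A n)" "(\<Union>n. A n) = UNIV"
  obtains n where "interior (A n) \<noteq> {}"
proof -
  have "\<exists>n. interior (A n) \<noteq> {}"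
  proof (rule ccontr)
    assume *: "\<not> (\<exists>n. interior (A n) \<noteq> {})"
    have "euclidean interior_of \<Union>(range A) = {}"
      by (rule Baire_category_alt) (use assms(1) * in \<open>auto simp: completely_metrizable_space_euclidean\<close>)
    then show False using assms(2) by simp
  qed
  then show thesis using that by blast
qed

subsection \<open>Distances to subspaces\<close>

context normed_space_over
begin

lemma bounded_linear_smul: "bounded_linear (smul c)"
proof (rule bounded_linear_intro)
  show "smul c (r *\<^sub>R x) = r *\<^sub>R smul c x" for r x
    using scale_left_commute[of c "of_real r" x] by (simp add: scale_of_real del: scale_scale)
  show "norm (smul c x) \<le> norm x * norm c" for x
    by (simp add: norm_scale mult.commute)
qed (simp add: scale_right_distrib)

lemma infdist_add_le:
  assumes "subspace Y"
  shows "infdist (x + y) Y \<le> infdist x Y + infdist y Y"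
proof -
  have ne: "Y \<noteq> {}" using subspace_0[OF assms] by blast
  show ?thesis
    unfolding infdist_notempty[OF ne, of x] infdist_notempty[OF ne, of y]
  proof (rule le_cINF_add[OF ne ne])
    fix a b
    assume "a \<in> Y" "b \<in> Y"
    then have "infdist (x + y) Y \<le> dist (x + y) (a + b)"
      by (intro infdist_le subspace_add[OF assms])
    also have "\<dots> \<le> dist x a + dist y b"
      by (rule dist_triangle_add)
    finally show "infdist (x + y) Y \<le> dist x a + dist y b" .
  qed
qed

lemma infdist_scale_le:
  assumes "subspace Y" "c \<noteq> 0"
  shows "infdist (smul c x) Y \<le> norm c * infdist x Y"
proof -
  have ne: "Y \<noteq> {}" using subspace_0[OF assms(1)] by blast
  show ?thesis
    unfolding infdist_notempty[OF ne, of x]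
  proof (rule le_mult_cINF[OF ne])
    fix a
    assume "a \<in> Y"
    then have "infdist (smul c x) Y \<le> dist (smul c x) (smul c a)"
      by (intro infdist_le subspace_scale[OF assms(1)])
    also have "\<dots> = norm c * dist x a"
      using norm_scale[of c "x - a"] by (simp add: dist_norm scale_right_diff_distrib)
    finally show "infdist (smul c x) Y \<le> norm c * dist x a" .
  qed (use assms(2) in simp)
qed

lemma infdist_scaleR_le:
  assumes "subspace Y" "r > 0"
  shows "infdist (r *\<^sub>R x) Y \<le> r * infdist x Y"
  using infdist_scale_le[OF assms(1), of "of_real r" x] assms(2) by (simp add: scale_of_real)

lemma infdist_diff_subspace:
  assumes "subspace Y" "y \<in> Y"
  shows "infdist (x - y) Y = infdist x Y"
proof (rule antisym)
  show "infdist (x - y) Y \<le> infdist x Y"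
    using infdist_add_le[OF assms(1), of x "- y"] subspace_neg[OF assms] by simp
  show "infdist x Y \<le> infdist (x - y) Y"
    using infdist_add_le[OF assms(1), of "x - y" y] assms(2) by simp
qed

text \<open>Both sides scale with \<open>y\<close>, so normalising reduces the bound to the unit
  sphere, where it is the defining supremum.\<close>

lemma infdist_le_rho0:
  assumes "subspace Z" "subspace Y" "y \<in> Z"
  shows "infdist y Y \<le> rho0 Z Y * norm y"
proof (cases "y = 0")
  case True
  then show ?thesis using subspace_0[OF assms(2)] by simp
next
  case False
  define c where "c = inverse (norm y)"
  have c: "c > 0" using False by (simp add: c_def)
  have "c *\<^sub>R y \<in> Z"
    using subspace_scale[OF assms(1,3), of "of_real c"] by (simp add: scale_of_real)
  moreover have "norm (c *\<^sub>R y) = 1"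
    using False by (simp add: c_def)
  moreover have "bdd_above ((\<lambda>y. infdist y Y) ` {y\<in>Z. norm y = 1})"
  proof (rule bdd_aboveI2)
    show "infdist y Y \<le> 1" if "y \<in> {y\<in>Z. norm y = 1}" for y
      using infdist_le_norm[OF assms(2), of y] that by simp
  qed
  ultimately have "infdist (c *\<^sub>R y) Y \<le> (SUP y\<in>{y\<in>Z. norm y = 1}. infdist y Y)"
    by (intro cSUP_upper) auto
  also have "\<dots> = rho0 Z Y"
    using assms(3) False by (auto simp: rho0_def)
  finally have "norm y * infdist (c *\<^sub>R y) Y \<le> norm y * rho0 Z Y"
    by (rule mult_left_mono) simp
  moreover have "infdist (norm y *\<^sub>R (c *\<^sub>R y)) Y \<le> norm y * infdist (c *\<^sub>R y) Y"
    using False by (intro infdist_scaleR_le[OF assms(2)]) auto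
  moreover have "norm y *\<^sub>R (c *\<^sub>R y) = y"
    using False by (simp add: c_def)
  ultimately show ?thesis
    by (simp add: mult.commute)
qed

text \<open>A converse to \<open>infdist_le_rho0\<close>; \<open>C \<ge> 0\<close> covers the value
  0 assigned to the zero subspace.\<close>

lemma rho0_le:
  assumes "subspace Z" "C \<ge> 0" "\<And>y. y \<in> Z \<Longrightarrow> infdist y Y \<le> C * norm y"
  shows "rho0 Z Y \<le> C"
proof (cases "Z = {0}")
  case False
  have "(SUP y\<in>{y\<in>Z. norm y = 1}. infdist y Y) \<le> C"
  proof (rule cSUP_least[OF unit_sphere_nonempty[OF assms(1) False]])
    show "infdist y Y \<le> C" if "y \<in> {y\<in>Z. norm y = 1}" for y
      using assms(3)[of y] that by simp
  qed
  then show ?thesis using False by (simp add: rho0_def)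
qed (use assms(2) in \<open>simp add: rho0_def\<close>)

text \<open>Translating \<open>z\<close> by \<open>a \<in> Y\<close> leaves its distance
  \<open>d\<close> to \<open>Y\<close> unchanged, so \<open>d \<le> \<theta> * norm (z - a)\<close>.
  The infimum over \<open>a\<close> gives \<open>d \<le> \<theta> * d\<close>, hence
  \<open>d = 0\<close>.\<close>

lemma closed_subspace_eq_UNIV:
  assumes Y: "subspace Y" "closed Y" and \<theta>: "0 \<le> \<theta>" "\<theta> < 1"
    and le: "\<And>x. infdist x Y \<le> \<theta> * norm x"
  shows "Y = UNIV"
proof -
  have ne: "Y \<noteq> {}" using subspace_0[OF Y(1)] by blast
  have "z \<in> Y" for z
  proof -
    define d where "d = infdist z Y"
    have "d \<le> \<theta> * d"
    proof (cases "\<theta> = 0")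
      case True
      then show ?thesis using le[of z] by (simp add: d_def)
    next
      case False
      have "d \<le> \<theta> * (INF a\<in>Y. dist z a)"
      proof (rule le_mult_cINF[OF ne])
        show "d \<le> \<theta> * dist z a" if "a \<in> Y" for a
          using le[of "z - a"] infdist_diff_subspace[OF Y(1) that] by (simp add: d_def dist_norm)
      qed (use False \<theta>(1) in simp)
      then show ?thesis by (simp add: d_def infdist_notempty[OF ne])
    qed
    then have "(1 - \<theta>) * d \<le> 0" by (simp add: algebra_simps)
    then have "d \<le> 0" using \<theta>(2) by (simp add: mult_le_0_iff)
    then have "d = 0" using infdist_nonneg[of z Y] by (simp add: d_def)
    then show ?thesis
      using in_closed_iff_infdist_zero[OF Y(2) ne] by (simp add: d_def)
  qed
  then show ?thesis by blast
qed

end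

subsection \<open>Absolutely convergent selections\<close>

locale closed_subspace_family = normed_space_over smul
  for smul :: "'k::real_or_complex \<Rightarrow> 'a::banach \<Rightarrow> 'a" +
  fixes \<Lambda> :: "'i set" and X :: "'i \<Rightarrow> 'a set"
  assumes index_nonempty: "\<Lambda> \<noteq> {}"
    and closed_subspace_X: "l \<in> \<Lambda> \<Longrightarrow> closed_subspace smul (X l)"
begin

lemma subspace_X: "l \<in> \<Lambda> \<Longrightarrow> subspace (X l)"
  and closed_X: "l \<in> \<Lambda> \<Longrightarrow> closed (X l)"
  using closed_subspace_X by (auto simp: closed_subspace_def)

definition selections :: "('i \<Rightarrow> 'a) set" where
  "selections = {u. (\<forall>l\<in>\<Lambda>. u l \<in> X l) \<and> u abs_summable_on \<Lambda>}"

definition cost :: "('i \<Rightarrow> 'a) \<Rightarrow> real" where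
  "cost u = (\<Sum>\<^sub>\<infinity>l\<in>\<Lambda>. norm (u l))"

lemma selections_D:
  assumes "u \<in> selections"
  shows "\<And>l. l \<in> \<Lambda> \<Longrightarrow> u l \<in> X l" "u abs_summable_on \<Lambda>" "u summable_on \<Lambda>"
  using assms abs_summable_summable by (auto simp: selections_def)

text \<open>By completeness absolute summability implies summability, so the relation
  \<open>has_sum\<close> becomes an equation for \<open>infsum\<close>.\<close>

lemma ARFS_iff_selections: "ARFS \<Lambda> X \<longleftrightarrow> (\<forall>x. \<exists>u\<in>selections. infsum u \<Lambda> = x)"
proof -
  have "(u has_sum x) \<Lambda> \<longleftrightarrow> infsum u \<Lambda> = x" if "u abs_summable_on \<Lambda>" for u and x :: 'a
    using abs_summable_summable[OF that] by (auto simp: infsumI)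
  then show ?thesis
    unfolding ARFS_def selections_def by blast
qed

lemma cost_nonneg: "cost u \<ge> 0"
  unfolding cost_def by (rule infsum_nonneg) simp

lemma zero_selection: "(\<lambda>_. 0) \<in> selections" "cost (\<lambda>_. 0) = 0"
  using subspace_0[OF subspace_X] by (auto simp: selections_def cost_def)

lemma selections_add:
  assumes "u \<in> selections" "v \<in> selections"
  shows "(\<lambda>l. u l + v l) \<in> selections" "cost (\<lambda>l. u l + v l) \<le> cost u + cost v"
proof -
  note uv = selections_D[OF assms(1)] selections_D[OF assms(2)]
  have sum: "(\<lambda>l. norm (u l) + norm (v l)) summable_on \<Lambda>"
    by (intro summable_on_add uv)
  have "(\<lambda>l. u l + v l) abs_summable_on \<Lambda>"
    using sum by (rule Infinite_Sum.abs_summable_on_comparison_test') (rule norm_triangle_ineq)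
  then show sel: "(\<lambda>l. u l + v l) \<in> selections"
    using uv subspace_add[OF subspace_X] by (auto simp: selections_def)
  have "cost (\<lambda>l. u l + v l) \<le> (\<Sum>\<^sub>\<infinity>l\<in>\<Lambda>. norm (u l) + norm (v l))"
    unfolding cost_def
    by (rule infsum_mono[OF selections_D(2)[OF sel] sum]) (rule norm_triangle_ineq)
  also have "\<dots> = cost u + cost v"
    unfolding cost_def by (intro infsum_add uv)
  finally show "cost (\<lambda>l. u l + v l) \<le> cost u + cost v" .
qed

lemma selections_scale:
  assumes "u \<in> selections"
  shows "(\<lambda>l. smul c (u l)) \<in> selections" "cost (\<lambda>l. smul c (u l)) = norm c * cost u"
    "infsum (\<lambda>l. smul c (u l)) \<Lambda> = smul c (infsum u \<Lambda>)"
proof -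
  note u = selections_D[OF assms]
  show "(\<lambda>l. smul c (u l)) \<in> selections"
    using u subspace_scale[OF subspace_X] summable_on_cmult_right[OF u(2), of "norm c"]
    by (auto simp: selections_def norm_scale)
  show "cost (\<lambda>l. smul c (u l)) = norm c * cost u"
    by (simp add: cost_def norm_scale infsum_cmult_right')
  show "infsum (\<lambda>l. smul c (u l)) \<Lambda> = smul c (infsum u \<Lambda>)"
    using has_sum_bounded_linear[OF bounded_linear_smul has_sum_infsum[OF u(3)]] by (rule infsumI)
qed

lemma singleton_selection:
  assumes "l \<in> \<Lambda>" "y \<in> X l"
  obtains u where "u \<in> selections" "cost u = norm y" "infsum u \<Lambda> = y"
proof
  define u where "u = (\<lambda>k. if k = l then y else 0)"
  have norm_u: "(\<lambda>k. norm (u k)) = (\<lambda>k. if k = l then norm y else 0)"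
    by (auto simp: u_def)
  have "((\<lambda>k. norm (u k)) has_sum norm y) \<Lambda>"
    unfolding norm_u by (rule has_sum_finite_neutralI[of "{l}"]) (use assms in auto)
  then show "u \<in> selections" "cost u = norm y"
    using assms subspace_0[OF subspace_X]
    by (auto simp: selections_def cost_def infsumI has_sum_imp_summable u_def)
  have "(u has_sum y) \<Lambda>"
    unfolding u_def by (rule has_sum_finite_neutralI[of "{l}"]) (use assms in auto)
  then show "infsum u \<Lambda> = y" by (rule infsumI)
qed

section \<open>Distances of absolutely convergent sums, and necessity\<close>

definition sup_rho :: "'a set \<Rightarrow> real" where
  "sup_rho Y = (SUP l\<in>\<Lambda>. rho0 (X l) Y)"

lemma infdist_le_sup_rho:
  assumes "subspace Y" "l \<in> \<Lambda>" "y \<in> X l"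
  shows "infdist y Y \<le> sup_rho Y * norm y"
proof -
  have "rho0 (X l) Y \<le> sup_rho Y"
    unfolding sup_rho_def using rho0_le_1[OF subspace_X assms(1)] assms(2)
    by (intro cSUP_upper bdd_aboveI2[where M = 1])
  then have "rho0 (X l) Y * norm y \<le> sup_rho Y * norm y"
    by (rule mult_right_mono) simp
  then show ?thesis
    using infdist_le_rho0[OF subspace_X[OF assms(2)] assms(1,3)] by simp
qed

text \<open>Subadditivity of the distance handles finite partial sums; the limit stays in the
  sublevel set, which is closed by continuity of \<open>infdist\<close>.\<close>

lemma infdist_infsum_le:
  assumes Y: "subspace Y" and u: "u \<in> selections" and s: "0 \<le> s" "sup_rho Y \<le> s"
  shows "infdist (infsum u \<Lambda>) Y \<le> s * cost u"
proof -
  have "infsum u \<Lambda> \<in> {x. infdist x Y \<le> s * cost u}"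
  proof (rule closed_infsum_mem[OF _ selections_D(3)[OF u]])
    show "closed {x. infdist x Y \<le> s * cost u}"
      by (intro closed_Collect_le continuous_intros)
    fix F
    assume F: "finite F" "F \<subseteq> \<Lambda>"
    have "infdist (sum u F) Y \<le> s * (\<Sum>l\<in>F. norm (u l))"
      using F
    proof (induction F rule: finite_induct)
      case empty
      then show ?case using subspace_0[OF Y] by simp
    next
      case (insert l F)
      have "infdist (u l) Y \<le> sup_rho Y * norm (u l)"
        using insert.prems selections_D(1)[OF u] by (intro infdist_le_sup_rho Y) auto
      also have "\<dots> \<le> s * norm (u l)"
        using s(2) by (rule mult_right_mono) simp
      finally show ?case
        using insert infdist_add_le[OF Y, of "u l" "sum u F"] by (simp add: algebra_simps)
    qed
    also have "\<dots> \<le> s * cost u"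
      unfolding cost_def using F s(1) selections_D(2)[OF u]
      by (intro mult_left_mono finite_sum_le_infsum) auto
    finally show "sum u F \<in> {x. infdist x Y \<le> s * cost u}" by simp
  qed
  then show ?thesis by simp
qed

text \<open>Each cost is at most some natural number, so the closed sets \<open>B n\<close> cover
  the space and Baire's theorem applies.\<close>

lemma ARFS_imp_ball:
  assumes "ARFS \<Lambda> X"
  obtains n :: nat and a r where "r > 0"
    "ball a r \<subseteq> closure {infsum u \<Lambda> | u. u \<in> selections \<and> cost u \<le> real n}"
proof -
  define B where "B n = closure {infsum u \<Lambda> | u. u \<in> selections \<and> cost u \<le> real n}" for n
  have "(\<Union>n. B n) = UNIV"
  proof (rule UNIV_eq_I[symmetric])
    fix x
    obtain u where u: "u \<in> selections" "infsum u \<Lambda> = x"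
      using assms ARFS_iff_selections by blast
    moreover obtain n :: nat where "cost u \<le> real n"
      using real_arch_simple by blast
    ultimately have "x \<in> B n"
      unfolding B_def by (intro closure_subset[THEN subsetD]) blast
    then show "x \<in> (\<Union>n. B n)" by blast
  qed
  moreover have "closed (B n)" for n
    by (simp add: B_def)
  ultimately obtain n where "interior (B n) \<noteq> {}"
    using Baire_interior_nonempty[of B] by metis
  then obtain a r where "r > 0" "ball a r \<subseteq> B n"
    by (meson all_not_in_conv mem_interior)
  then show thesis
    using that by (simp add: B_def)
qed

lemma ARFS_imp_sup_rho_ge:
  assumes "ARFS \<Lambda> X"
  obtains \<epsilon> where "\<epsilon> > 0" "\<And>Y. closed_subspace smul Y \<Longrightarrow> Y \<noteq> UNIV \<Longrightarrow> sup_rho Y \<ge> \<epsilon>"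
proof -
  obtain n :: nat and a r where r: "r > 0"
    and ball: "ball a r \<subseteq> closure {infsum u \<Lambda> | u. u \<in> selections \<and> cost u \<le> real n}"
    using ARFS_imp_ball[OF assms] by blast
  \<comment> \<open>Chosen so that two distances of at most \<open>\<epsilon> * real n\<close> add
    up to at most \<open>r / 4\<close>; \<open>Suc\<close> keeps the denominator nonzero when
    \<open>n = 0\<close>.\<close>
  define \<epsilon> where "\<epsilon> = r / (8 * real (Suc n))"
  have \<epsilon>: "\<epsilon> > 0" "4 * real n * \<epsilon> \<le> r / 2"
    using r by (auto simp: \<epsilon>_def field_simps)
  show thesis
  proof (rule that[OF \<epsilon>(1)])
    fix Y
    assume Y: "closed_subspace smul Y" and "Y \<noteq> UNIV"
    then have sub: "subspace Y" and clo: "closed Y"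
      by (auto simp: closed_subspace_def)
    show "sup_rho Y \<ge> \<epsilon>"
    proof (rule ccontr)
      assume "\<not> sup_rho Y \<ge> \<epsilon>"
      then have le: "sup_rho Y \<le> \<epsilon>" by simp
      have "closure {infsum u \<Lambda> | u. u \<in> selections \<and> cost u \<le> real n} \<subseteq> {x. infdist x Y \<le> \<epsilon> * real n}"
      proof (rule closure_minimal)
        show "closed {x. infdist x Y \<le> \<epsilon> * real n}"
          by (intro closed_Collect_le continuous_intros)
        have "infdist (infsum u \<Lambda>) Y \<le> \<epsilon> * real n" if "u \<in> selections" "cost u \<le> real n" for u
        proof -
          have "infdist (infsum u \<Lambda>) Y \<le> \<epsilon> * cost u"
            using \<epsilon>(1) le by (intro infdist_infsum_le sub that) auto
          also have "\<dots> \<le> \<epsilon> * real n"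
            using \<epsilon>(1) that(2) by (intro mult_left_mono) auto
          finally show ?thesis .
        qed
        then show "{infsum u \<Lambda> | u. u \<in> selections \<and> cost u \<le> real n} \<subseteq> {x. infdist x Y \<le> \<epsilon> * real n}"
          by blast
      qed
      with ball have near: "infdist x Y \<le> \<epsilon> * real n" if "dist a x < r" for x
        using that by (auto simp: subset_iff)
      \<comment> \<open>The estimate moves from the ball around \<open>a\<close> to the ball around
        0 by writing \<open>x\<close> as \<open>(a + x) + (- a)\<close>.\<close>
      have small: "infdist x Y \<le> r / 4" if "norm x < r" for x
      proof -
        have "infdist (- a) Y \<le> infdist a Y"
          using infdist_scale_le[OF sub, of "-1" a] by simp
        moreover have "infdist x Y \<le> infdist (a + x) Y + infdist (- a) Y"
          using infdist_add_le[OF sub, of "a + x" "- a"] by simp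
        moreover have "infdist (a + x) Y \<le> \<epsilon> * real n" "infdist a Y \<le> \<epsilon> * real n"
          using that r by (auto intro!: near simp: dist_norm)
        ultimately show ?thesis using \<epsilon>(2) by (simp add: mult.commute)
      qed
      have "infdist x Y \<le> (1/2) * norm x" for x
      proof (cases "x = 0")
        case True
        then show ?thesis using subspace_0[OF sub] by simp
      next
        case False
        \<comment> \<open>This scales \<open>x\<close> to norm \<open>r / 2\<close>, where the
          distance bound \<open>r / 4\<close> is half the norm.\<close>
        define c where "c = r / (2 * norm x)"
        have c: "c > 0" "norm (c *\<^sub>R x) < r"
          using False r by (auto simp: c_def)
        have "infdist x Y \<le> inverse c * infdist (c *\<^sub>R x) Y"
          using infdist_scaleR_le[OF sub, of "inverse c" "c *\<^sub>R x"] c(1) by simp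
        also have "\<dots> \<le> inverse c * (r / 4)"
          using c small by (intro mult_left_mono) auto
        finally show ?thesis
          using False r by (simp add: c_def field_simps)
      qed
      then have "Y = UNIV"
        using closed_subspace_eq_UNIV[OF sub clo, of "1/2"] by simp
      with \<open>Y \<noteq> UNIV\<close> show False by simp
    qed
  qed
qed

section \<open>Sufficiency: successive approximation and a separating functional\<close>

lemma ARFS_if_approximable:
  assumes \<theta>: "0 \<le> \<theta>" "\<theta> < 1" and M: "M \<ge> 0"
    and approx: "\<And>x. \<exists>u\<in>selections. cost u \<le> M * norm x \<and> norm (x - infsum u \<Lambda>) \<le> \<theta> * norm x"
  shows "ARFS \<Lambda> X"
  unfolding ARFS_iff_selections
proof
  fix x
  obtain U where U: "\<And>x. U x \<in> selections" "\<And>x. cost (U x) \<le> M * norm x"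
    "\<And>x. norm (x - infsum (U x) \<Lambda>) \<le> \<theta> * norm x"
    using approx by metis
  \<comment> \<open>The remainder after \<open>n\<close> rounds, each subtracting the sum of the
    selection chosen for the current remainder. Remainders and costs are dominated by geometric
    series.\<close>
  define y where "y n = ((\<lambda>z. z - infsum (U z) \<Lambda>) ^^ n) x" for n
  have y_0: "y 0 = x" and y_Suc: "y (Suc n) = y n - infsum (U (y n)) \<Lambda>" for n
    by (simp_all add: y_def)
  have norm_y: "norm (y n) \<le> \<theta> ^ n * norm x" for n
  proof (induction n)
    case (Suc n)
    have "norm (y (Suc n)) \<le> \<theta> * norm (y n)"
      using U(3)[of "y n"] by (simp add: y_Suc)
    also have "\<dots> \<le> \<theta> * (\<theta> ^ n * norm x)"
      using Suc \<theta>(1) by (rule mult_left_mono)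
    finally show ?case by simp
  qed (simp add: y_0)
  have geom: "summable (\<lambda>n. \<theta> ^ n * c)" for c
    using \<theta> by (intro summable_mult2 summable_geometric) simp
  have "y \<longlonglongrightarrow> 0"
    using norm_y summable_LIMSEQ_zero[OF geom] by (rule Lim_null_comparison[OF always_eventually[OF allI]])
  \<comment> \<open>All terms of all rounds as one absolutely summable double family. Summing within
    each round first telescopes to \<open>x\<close>; summing over rounds at a fixed index gives the
    decomposition \<open>v\<close>.\<close>
  define w where "w = (\<lambda>(n, l). U (y n) l)"
  have w_l: "(\<lambda>l. w (n, l)) = U (y n)" for n by (simp add: w_def)
  have "summable (\<lambda>n. cost (U (y n)))"
  proof (rule summable_comparison_test_ev[OF always_eventually geom[of "M * norm x"]], rule allI)
    fix n
    have "M * norm (y n) \<le> M * (\<theta> ^ n * norm x)"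
      using norm_y M by (rule mult_left_mono)
    then show "norm (cost (U (y n))) \<le> \<theta> ^ n * (M * norm x)"
      using U(2)[of "y n"] cost_nonneg[of "U (y n)"] by (simp add: algebra_simps)
  qed
  then have "(\<lambda>n. cost (U (y n))) summable_on UNIV"
    using cost_nonneg by (intro norm_summable_imp_summable_on) simp
  then have "w abs_summable_on UNIV \<times> \<Lambda>"
    unfolding Infinite_Sum.abs_summable_on_Sigma_iff using cost_nonneg selections_D(2)[OF U(1)]
    by (simp add: w_def flip: cost_def)
  then have w_swap: "(\<lambda>(l, n). w (n, l)) abs_summable_on \<Lambda> \<times> UNIV"
    and w_sum: "(w has_sum infsum w (UNIV \<times> \<Lambda>)) (UNIV \<times> \<Lambda>)"
    using summable_on_swap[of "\<lambda>p. norm (w p)" UNIV \<Lambda>] abs_summable_summable[of w]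
    by (simp_all add: case_prod_unfold)
  have "((\<lambda>n. infsum (U (y n)) \<Lambda>) has_sum infsum w (UNIV \<times> \<Lambda>)) UNIV"
    by (rule has_sum_SigmaD[OF w_sum]) (use selections_D(3)[OF U(1)] in \<open>simp add: w_l\<close>)
  then have "(\<lambda>n. y n - y (Suc n)) sums infsum w (UNIV \<times> \<Lambda>)"
    by (simp add: y_Suc has_sum_imp_sums)
  moreover have "(\<lambda>n. y n - y (Suc n)) sums (y 0 - 0)"
    using \<open>y \<longlonglongrightarrow> 0\<close> by (rule telescope_sums')
  ultimately have total: "infsum w (UNIV \<times> \<Lambda>) = x"
    using sums_unique2 y_0 by fastforce
  define v where "v l = (\<Sum>\<^sub>\<infinity>n. w (n, l))" for l
  have row: "(\<lambda>n. w (n, l)) abs_summable_on UNIV" if "l \<in> \<Lambda>" for l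
    using w_swap that unfolding Infinite_Sum.abs_summable_on_Sigma_iff by auto
  have "((\<lambda>(l, n). w (n, l)) has_sum x) (\<Lambda> \<times> UNIV)"
    using w_sum total has_sum_swap[of w] by blast
  then have "(v has_sum x) \<Lambda>"
    by (rule has_sum_SigmaD) (use abs_summable_summable[OF row] in \<open>auto simp: v_def\<close>)
  moreover have "v abs_summable_on \<Lambda>"
  proof (rule Infinite_Sum.abs_summable_on_comparison_test)
    show "(\<lambda>l. \<Sum>\<^sub>\<infinity>n. norm (w (n, l))) abs_summable_on \<Lambda>"
      using w_swap unfolding Infinite_Sum.abs_summable_on_Sigma_iff by simp
    show "norm (v l) \<le> norm (\<Sum>\<^sub>\<infinity>n. norm (w (n, l)))" if "l \<in> \<Lambda>" for l
      using norm_infsum_bound[OF row[OF that]] by (simp add: v_def infsum_nonneg)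
  qed
  \<comment> \<open>Closedness of \<open>X l\<close> is used here: \<open>v l\<close> is an infinite
    sum of its elements.\<close>
  moreover have "v l \<in> X l" if l: "l \<in> \<Lambda>" for l
    unfolding v_def
  proof (rule closed_infsum_mem[OF closed_X[OF l] abs_summable_summable[OF row[OF l]]])
    show "(\<Sum>n\<in>F. w (n, l)) \<in> X l" for F
      using selections_D(1)[OF U(1) l] by (intro subspace_sum[OF subspace_X[OF l]]) (simp add: w_def)
  qed
  ultimately have "v \<in> selections" "infsum v \<Lambda> = x"
    by (simp_all add: selections_def infsumI)
  then show "\<exists>u\<in>selections. infsum u \<Lambda> = x"
    by blast
qed

lemma sup_rho_ge_imp_ARFS:
  assumes \<epsilon>: "\<epsilon> > 0" "\<And>Y. closed_subspace smul Y \<Longrightarrow> Y \<noteq> UNIV \<Longrightarrow> sup_rho Y \<ge> \<epsilon>"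
  shows "ARFS \<Lambda> X"
proof -
  define M where "M = 4 / \<epsilon>"
  have M: "M > 0" using \<epsilon>(1) by (simp add: M_def)
  define g where "g x u = cost u + M * norm (x - infsum u \<Lambda>)" for x u
  \<comment> \<open>The zero selection shows \<open>q x \<le> M * norm x\<close>; a single-term
    selection improves this to \<open>q y \<le> norm y\<close> on each \<open>X l\<close>.\<close>
  define q where "q x = (INF u\<in>selections. g x u)" for x
  have g_nonneg: "g x u \<ge> 0" for x u
    using cost_nonneg[of u] M by (simp add: g_def)
  have ne: "selections \<noteq> {}" using zero_selection by blast
  have bdd: "bdd_below (g x ` selections)" for x
    using g_nonneg by (intro bdd_belowI2[where m = 0])
  have q_le: "q x \<le> g x u" if "u \<in> selections" for x u
    unfolding q_def using bdd that by (rule cINF_lower)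
  have q_nonneg: "q x \<ge> 0" for x
    unfolding q_def using ne g_nonneg by (intro cINF_greatest)
  have q_le_norm: "q x \<le> M * norm x" for x
    using q_le[OF zero_selection(1), of x] zero_selection(2) by (simp add: g_def)
  have q_le_norm_X: "q y \<le> norm y" if "l \<in> \<Lambda>" "y \<in> X l" for l y
  proof -
    obtain u where "u \<in> selections" "cost u = norm y" "infsum u \<Lambda> = y"
      using singleton_selection[OF \<open>l \<in> \<Lambda>\<close> \<open>y \<in> X l\<close>] by blast
    then show ?thesis using q_le[of u y] by (simp add: g_def)
  qed
  have q_add: "q (x + y) \<le> q x + q y" for x y
    unfolding q_def[of x] q_def[of y]
  proof (rule le_cINF_add[OF ne ne])
    fix u v
    assume uv: "u \<in> selections" "v \<in> selections"
    have "norm (x + y - infsum (\<lambda>l. u l + v l) \<Lambda>) \<le> norm (x - infsum u \<Lambda>) + norm (y - infsum v \<Lambda>)"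
      using uv norm_triangle_ineq[of "x - infsum u \<Lambda>" "y - infsum v \<Lambda>"]
      by (simp add: infsum_add selections_D algebra_simps)
    then have "M * norm (x + y - infsum (\<lambda>l. u l + v l) \<Lambda>) \<le>
        M * norm (x - infsum u \<Lambda>) + M * norm (y - infsum v \<Lambda>)"
      using M by (simp flip: distrib_left)
    then show "q (x + y) \<le> g x u + g y v"
      using q_le[OF selections_add(1)[OF uv], of "x + y"] selections_add(2)[OF uv]
      by (simp add: g_def)
  qed
  have q_scale_le: "q (smul c x) \<le> norm c * q x" if "c \<noteq> 0" for c x
    unfolding q_def[of x]
  proof (rule le_mult_cINF[OF ne])
    fix u
    assume u: "u \<in> selections"
    have "norm (smul c x - smul c (infsum u \<Lambda>)) = norm c * norm (x - infsum u \<Lambda>)"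
      by (simp add: norm_scale flip: scale_right_diff_distrib)
    then show "q (smul c x) \<le> norm c * g x u"
      using q_le[OF selections_scale(1)[OF u], of "smul c x" c] selections_scale(2,3)[OF u, of c]
      by (simp add: g_def algebra_simps)
  qed (use that in simp)
  have q_scale: "q (smul c x) = norm c * q x" for c x
  proof (cases "c = 0")
    case True
    then show ?thesis using q_le_norm[of 0] q_nonneg[of 0] by simp
  next
    case False
    then have "q x \<le> inverse (norm c) * q (smul c x)"
      using q_scale_le[of "inverse c" "smul c x"] by (simp add: norm_inverse)
    then show ?thesis
      using q_scale_le[OF False, of x] False by (simp add: field_simps)
  qed
  have q_half: "q a \<le> M / 2 * norm a" for a
  proof (rule ccontr)
    assume "\<not> q a \<le> M / 2 * norm a"
    then have qa: "M / 2 * norm a < q a" by simp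
    obtain F :: "'a \<Rightarrow> 'k" where F_add: "\<And>x y. F (x + y) = F x + F y"
      and F_scale: "\<And>c x. F (smul c x) = c * F x"
      and F_le: "\<And>x. norm (F x) \<le> q x" and F_a: "q a \<le> norm (F a)"
      using Hahn_Banach[of q a, OF q_add q_scale] by blast
    have Fa_pos: "norm (F a) > 0"
    proof -
      have "0 \<le> M / 2 * norm a" using M by simp
      with qa F_a show ?thesis by linarith
    qed
    define Y where "Y = {x. F x = 0}"
    have F_0: "F 0 = 0" using F_scale[of 0 0] by simp
    have sub: "subspace Y"
      by (rule subspaceI) (auto simp: Y_def F_add F_scale F_0)
    have "bounded_linear F"
    proof (rule bounded_linear_intro)
      show "F (r *\<^sub>R x) = r *\<^sub>R F x" for r x
        using F_scale[of "of_real r" x] by (simp add: scale_of_real scaleR_conv_of_real)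
      show "norm (F x) \<le> norm x * M" for x
        using F_le[of x] q_le_norm[of x] by (simp add: mult.commute)
    qed (rule F_add)
    then have "closed Y"
      unfolding Y_def by (intro closed_Collect_eq linear_continuous_on continuous_on_const)
    moreover have "Y \<noteq> UNIV" using Fa_pos by (auto simp: Y_def)
    ultimately have "\<epsilon> \<le> sup_rho Y"
      using \<epsilon>(2) sub by (simp add: closed_subspace_def)
    also have "sup_rho Y \<le> 2 / M"
      unfolding sup_rho_def
    proof (rule cSUP_least[OF index_nonempty], rule rho0_le)
      fix l y
      assume l: "l \<in> \<Lambda>" and y: "y \<in> X l"
      \<comment> \<open>Subtracting the multiple of \<open>a\<close> with the same value under
        \<open>F\<close> projects \<open>y\<close> into the kernel, and the norm of that multiple
        bounds the distance from \<open>y\<close> to \<open>Y\<close>.\<close>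
      have "F (y - smul (F y / F a) a) = 0"
        using F_add[of "y - smul (F y / F a) a" "smul (F y / F a) a"] Fa_pos
        by (simp add: F_scale)
      then have "infdist y Y \<le> dist y (y - smul (F y / F a) a)"
        by (intro infdist_le) (simp add: Y_def)
      also have "\<dots> = norm (F y) * (norm a / norm (F a))"
        by (simp add: dist_norm norm_scale norm_divide)
      also have "\<dots> \<le> norm y * (2 / M)"
      proof (rule mult_mono)
        show "norm (F y) \<le> norm y"
          using F_le[of y] q_le_norm_X[OF l y] by simp
        show "norm a / norm (F a) \<le> 2 / M"
          using qa F_a Fa_pos M by (simp add: field_simps)
      qed auto
      finally show "infdist y Y \<le> 2 / M * norm y" by (simp add: mult.commute)
    qed (use M subspace_X in auto)
    \<comment> \<open>By the choice of \<open>M\<close>, the bound \<open>2 / M\<close> equals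
      \<open>\<epsilon> / 2\<close>.\<close>
    finally show False
      using \<epsilon>(1) by (simp add: M_def field_simps)
  qed
  show ?thesis
  proof (rule ARFS_if_approximable)
    fix x
    show "\<exists>u\<in>selections. cost u \<le> M * norm x \<and> norm (x - infsum u \<Lambda>) \<le> 3/4 * norm x"
    proof (cases "x = 0")
      case True
      then show ?thesis using zero_selection by (intro bexI[of _ "\<lambda>_. 0"]) auto
    next
      case False
      \<comment> \<open>The gap between 1/2 and 3/4 makes the inequality strict for
        \<open>x \<noteq> 0\<close>, so some selection stays below the bound. Both summands of
        \<open>g x u\<close> are nonnegative, hence each is bounded separately.\<close>
      have "q x < M * (3/4 * norm x)"
        using q_half[of x] mult_pos_pos[OF M, of "norm x"] False by simp
      then obtain u where u: "u \<in> selections" "g x u < M * (3/4 * norm x)"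
        unfolding q_def using cINF_less_iff[OF ne bdd] by blast
      have "M * norm (x - infsum u \<Lambda>) \<le> M * (3/4 * norm x)"
        using u(2) cost_nonneg[of u] by (simp add: g_def)
      then have "norm (x - infsum u \<Lambda>) \<le> 3/4 * norm x"
        using M by (rule mult_left_le_imp_le)
      moreover have "cost u \<le> M * norm x"
      proof -
        have "0 \<le> M * norm (x - infsum u \<Lambda>)" "0 \<le> M * norm x"
          using M by simp_all
        then show ?thesis using u(2) by (simp add: g_def)
      qed
      ultimately show ?thesis using u(1) by blast
    qed
  qed (use M in auto)
qed

end

theorem theorem4p2:
  fixes smul :: "'k::real_or_complex \<Rightarrow> 'a::banach \<Rightarrow> 'a"
    and \<Lambda> :: "'i set"
    and X :: "'i \<Rightarrow> 'a set"
  assumes "normed_space_over smul"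
    and "\<Lambda> \<noteq> {}"
    and "\<And>l. l \<in> \<Lambda> \<Longrightarrow> closed_subspace smul (X l)"
  shows "ARFS \<Lambda> X \<longleftrightarrow>
    (\<exists>\<epsilon>>0. \<forall>Y. closed_subspace smul Y \<and> Y \<noteq> UNIV \<longrightarrow> (SUP l\<in>\<Lambda>. rho0 (X l) Y) \<ge> \<epsilon>)"
proof -
  interpret normed_space_over smul by fact
  interpret closed_subspace_family smul \<Lambda> X
    by unfold_locales (use assms in auto)
  show ?thesis
    unfolding sup_rho_def[symmetric]
  proof
    assume "ARFS \<Lambda> X"
    then obtain \<epsilon> where "\<epsilon> > 0" "\<And>Y. closed_subspace smul Y \<Longrightarrow> Y \<noteq> UNIV \<Longrightarrow> sup_rho Y \<ge> \<epsilon>"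
      by (rule ARFS_imp_sup_rho_ge) blast
    then show "\<exists>\<epsilon>>0. \<forall>Y. closed_subspace smul Y \<and> Y \<noteq> UNIV \<longrightarrow> sup_rho Y \<ge> \<epsilon>"
      by blast
  next
    assume "\<exists>\<epsilon>>0. \<forall>Y. closed_subspace smul Y \<and> Y \<noteq> UNIV \<longrightarrow> sup_rho Y \<ge> \<epsilon>"
    then show "ARFS \<Lambda> X"
      using sup_rho_ge_imp_ARFS by blast
  qed
qed

end
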